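(* Let $(\alpha_i,N_i)$ be a semi-fast convergent sequence with $\alpha_i>(N_{i+1}+1)\alpha_{i+1}$ for each $i\in\mathbb{N}$. Then: (1) the number of semi-fast convergent representations of the achievement set $E(\alpha_i,N_i)$ is equal to the continuum $\mathfrak{c}$ if and only if $N_i+1$ is not a prime number for infinitely many $i$; (2) if $N_i+1$ is a prime number for all but finitely many $i$, then the number of semi-fast convergent representations of $E(\alpha_i,N_i)$ is equal to $\prod_{i=1}^{\infty}R(N_i)$. In particular, $E(\alpha_i,N_i)$ has a unique semi-fast convergent representation (the one given by the constant segments of $\alpha_i$'s, i.e. $(\alpha_i,N_i)$ itself) if and only if $N_i+1$ is a prime number for each $i$.
   Context: All infinite sequences $(x_n)_{n\in\mathbb{N}}$ considered are non-increasing, summable sequences of positive real numbers. The achievement set of $(x_n)$ is $E(x_n)=\{\sum_{n\in A}x_n : A\subset\mathbb{N}\}$; a representation of a set $E$ is any such sequence $(x_n)$ with $E(x_n)=E$. A sequence $(x_n)$ is semi-fast convergent if $x_n>\sum_{k:\,x_k<x_n}x_k$ for every $n$. For a strictly decreasing sequence $(\alpha_k)$ of positive reals tending to $0$ and positive integers $N_k$, $(\alpha_k,N_k)$ denotes the sequence $(\underbrace{\alpha_1,\ldots,\alpha_1}_{N_1},\underbrace{\alpha_2,\ldots,\alpha_2}_{N_2},\ldots)$ and $E(\alpha_k,N_k)$ its achievement set; it is semi-fast convergent iff $\alpha_k>\sum_{n>k}N_n\alpha_n$ for each $k$. For $n\ge 1$, $R(n)$ denotes the number of finite non-decreasing sequences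 $(z_j)_{j=1}^{m}$ of positive integers (of any length $m$) with $\sum_{j=1}^m z_j=n$ that are complete, i.e. $\{\sum_{j\in A}z_j : A\subset\{1,\ldots,m\}\}=\{0,1,\ldots,n\}$, and semi-fast, i.e. $z_p>\sum_{j:\,z_j<z_p}z_j$ for every $p\in\{1,\ldots,m\}$. *)

theory Defs
  imports "HOL-Analysis.Analysis" "HOL-Library.Equipollence"
    "HOL-Computational_Algebra.Primes"
begin

definition admissible_seq :: "(nat \<Rightarrow> real) \<Rightarrow> bool" where
  "admissible_seq x \<longleftrightarrow> decseq x \<and> summable x \<and> (\<forall>n. 0 < x n)"

definition achievement_set :: "(nat \<Rightarrow> real) \<Rightarrow> real set" where
  "achievement_set x = {(\<Sum>\<^sub>\<infinity>n\<in>A. x n) | A. A \<subseteq> UNIV}"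

definition semi_fast_convergent :: "(nat \<Rightarrow> real) \<Rightarrow> bool" where
  "semi_fast_convergent x \<longleftrightarrow>
     admissible_seq x \<and> (\<forall>n. x n > (\<Sum>\<^sub>\<infinity>k\<in>{k. x k < x n}. x k))"

definition semi_fast_representations :: "real set \<Rightarrow> (nat \<Rightarrow> real) set" where
  "semi_fast_representations E = {x. semi_fast_convergent x \<and> achievement_set x = E}"

text \<open>
  The sequence that repeats \<open>\<alpha> 0\<close> exactly \<open>N 0\<close> times, then \<open>\<alpha> 1\<close> exactly \<open>N 1\<close> times,
  and so on.  It is meaningful when all \<open>N k\<close> are positive, so that every index lies in
  some block.
\<close>

definition block_seq :: "(nat \<Rightarrow> real) \<Rightarrow> (nat \<Rightarrow> nat) \<Rightarrow> nat \<Rightarrow> real" where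
  "block_seq \<alpha> N n = \<alpha> (LEAST k. n < (\<Sum>i\<le>k. N i))"

definition complete_list :: "nat list \<Rightarrow> bool" where
  "complete_list zs \<longleftrightarrow>
     {(\<Sum>j\<in>A. zs ! j) | A. A \<subseteq> {..<length zs}} = {0..sum_list zs}"

definition semi_fast_list :: "nat list \<Rightarrow> bool" where
  "semi_fast_list zs \<longleftrightarrow>
     (\<forall>p<length zs. zs ! p > (\<Sum>j | j < length zs \<and> zs ! j < zs ! p. zs ! j))"

definition R :: "nat \<Rightarrow> nat" where
  "R n = card {zs. sorted zs \<and> (\<forall>z\<in>set zs. 0 < z) \<and> sum_list zs = n \<and>
                   complete_list zs \<and> semi_fast_list zs}"

end

theory Submission imports Defs begin

text \<open>
  The achievement set consists of the digit sums \<open>\<Sum>d\<^sub>i\<alpha>\<^sub>i\<close> with \<open>d\<^sub>i \<le> N\<^sub>i\<close>. Replacing every block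
  \<open>\<alpha>\<^sub>i, \<dots>, \<alpha>\<^sub>i\<close> by \<open>z\<alpha>\<^sub>i\<close>, with \<open>z\<close> running through a complete semi-fast partition of \<open>N\<^sub>i\<close>, yields
  another semi-fast representation. There are no others: with \<open>r\<^sub>i = \<Sum>\<^sub>j\<^sub>>\<^sub>iN\<^sub>j\<alpha>\<^sub>j\<close>, the assumption
  \<open>\<alpha>\<^sub>i > (N\<^sub>i\<^sub>+\<^sub>1 + 1)\<alpha>\<^sub>i\<^sub>+\<^sub>1\<close> says that the gap lengths \<open>\<alpha>\<^sub>i - r\<^sub>i\<close> strictly decrease, so the gap
  \<open>(r\<^sub>i, \<alpha>\<^sub>i)\<close> is longer than all gaps to its left. The terms of a representation that are at most \<open>r\<^sub>i\<close>
  have subsums too dense to jump over this gap, so they add up to exactly \<open>r\<^sub>i\<close>. For the same reason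
  the terms between \<open>\<alpha>\<^sub>i\<close> and \<open>r\<^sub>i\<^sub>-\<^sub>1\<close> are integer multiples of \<open>\<alpha>\<^sub>i\<close>, and the multipliers form a
  complete semi-fast partition of \<open>N\<^sub>i\<close>. It remains to count families of partitions: \<open>R(n) = 1\<close>
  if and only if \<open>n + 1\<close> is prime.
\<close>

section \<open>Sums over blocks of indices\<close>

text \<open>Disjointness makes \<open>snd\<close> injective on \<open>Sigma I B\<close>, so the sum
  over the union can be reindexed and evaluated fibre by fibre.\<close>

lemma infsum_UN_disjoint_family:
  fixes y :: "'b \<Rightarrow> real"
  assumes "y summable_on (\<Union>i\<in>I. B i)" "disjoint_family_on B I"
  shows "infsum y (\<Union>i\<in>I. B i) = (\<Sum>\<^sub>\<infinity>i\<in>I. infsum y (B i))"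
proof -
  have inj: "inj_on snd (Sigma I B)"
    using assms(2) by (force simp: disjoint_family_on_def inj_on_def)
  have img: "snd ` Sigma I B = (\<Union>i\<in>I. B i)"
    by force
  have "(y \<circ> snd) summable_on Sigma I B"
    using assms(1) inj img by (metis summable_on_reindex)
  from infsum_Sigma_banach[OF this] show ?thesis
    using infsum_reindex[OF inj, of y] by (simp add: img)
qed

lemma summable_on_UN_disjoint_family:
  fixes y :: "'b \<Rightarrow> real"
  assumes "y summable_on (\<Union>i\<in>I. B i)" "disjoint_family_on B I"
  shows "(\<lambda>i. infsum y (B i)) summable_on I"
proof -
  have inj: "inj_on snd (Sigma I B)"
    using assms(2) by (force simp: disjoint_family_on_def inj_on_def)
  have "snd ` Sigma I B = (\<Union>i\<in>I. B i)"
    by force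
  then have "(y \<circ> snd) summable_on Sigma I B"
    using assms(1) inj by (metis summable_on_reindex)
  moreover have "y summable_on B i" if "i \<in> I" for i
    using assms(1) by (rule summable_on_subset_banach) (use that in blast)
  ultimately show ?thesis
    using summable_on_SigmaD[of "y \<circ> snd" I B] by simp
qed

lemma infsum_atLeast_small:
  fixes y :: "nat \<Rightarrow> real"
  assumes "y summable_on UNIV" "0 < e"
  obtains m where "n \<le> m" "infsum y {m..} < e"
proof -
  have "y sums infsum y UNIV"
    using assms(1) by (simp add: has_sum_imp_sums)
  then have "(\<lambda>m. sum y {..<m}) \<longlonglongrightarrow> infsum y UNIV"
    by (simp add: sums_def)
  then have "\<forall>\<^sub>F m in sequentially. infsum y UNIV - e < sum y {..<m}"
    using assms(2) by (intro order_tendstoD) auto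
  then obtain m0 where m0: "\<And>m. m0 \<le> m \<Longrightarrow> infsum y UNIV - e < sum y {..<m}"
    by (auto simp: eventually_sequentially)
  let ?m = "max n m0"
  have "infsum y ({..<?m} \<union> {?m..}) = infsum y {..<?m} + infsum y {?m..}"
    using assms(1) by (intro infsum_Un_disjoint) (auto intro: summable_on_subset_banach)
  moreover have "{..<?m} \<union> {?m..} = UNIV" by auto
  ultimately show ?thesis
    using m0[of ?m] by (intro that[of ?m]) simp_all
qed

lemma infsum_atLeast_split:
  fixes y :: "nat \<Rightarrow> real"
  assumes "y summable_on UNIV" "n \<le> m"
  shows "infsum y {n..} = sum y {n..<m} + infsum y {m..}"
proof -
  have "infsum y ({n..<m} \<union> {m..}) = infsum y {n..<m} + infsum y {m..}"
    using assms(1) by (intro infsum_Un_disjoint) (auto intro: summable_on_subset_banach)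
  moreover have "{n..<m} \<union> {m..} = {n..}" using assms(2) by auto
  ultimately show ?thesis by simp
qed

section \<open>Consecutive blocks of indices with lengths \<open>L\<close>\<close>

definition offset :: "(nat \<Rightarrow> nat) \<Rightarrow> nat \<Rightarrow> nat" where
  "offset L i = (\<Sum>j<i. L j)"

abbreviation block :: "(nat \<Rightarrow> nat) \<Rightarrow> nat \<Rightarrow> nat set" where
  "block L i \<equiv> {offset L i..<offset L (Suc i)}"

lemma offset_Suc: "offset L (Suc i) = offset L i + L i"
  by (simp add: offset_def)

lemma offset_mono: "i \<le> j \<Longrightarrow> offset L i \<le> offset L j"
  unfolding offset_def by (intro sum_mono2) auto

lemma le_offset:
  assumes "\<And>i. 0 < L i"
  shows "i \<le> offset L i"
proof (induction i)
  case (Suc i)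
  then show ?case using assms[of i] by (simp add: offset_Suc)
qed simp

lemma block_unique:
  assumes "n \<in> block L i" "n \<in> block L j"
  shows "i = j"
proof -
  have "\<not> i < j" "\<not> j < i"
    using assms offset_mono[of "Suc i" j L] offset_mono[of "Suc j" i L] by auto
  then show ?thesis by simp
qed

lemma disjoint_family_on_block: "disjoint_family_on (\<lambda>i. A \<inter> block L i) I"
  unfolding disjoint_family_on_def using block_unique[of _ L] by blast

lemma in_some_block:
  assumes "\<And>i. 0 < L i"
  obtains i where "n \<in> block L i"
proof -
  define k where "k = (LEAST k. n < offset L k)"
  have ex: "n < offset L (Suc n)"
    using le_offset[of L "Suc n"] assms by simp
  then have k: "n < offset L k"
    unfolding k_def by (rule LeastI)
  then obtain i where i: "k = Suc i"
    by (cases k) (auto simp: offset_def)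
  have "\<not> n < offset L i"
    unfolding k_def using i k_def not_less_Least[of i "\<lambda>k. n < offset L k"] by simp
  with k i show ?thesis by (intro that[of i]) auto
qed

lemma block_Least:
  assumes "n \<in> block L i"
  shows "(LEAST k. n < (\<Sum>j\<le>k. L j)) = i"
proof (rule Least_equality)
  show "n < (\<Sum>j\<le>i. L j)"
    using assms by (simp add: offset_def lessThan_Suc_atMost)
next
  fix k assume "n < (\<Sum>j\<le>k. L j)"
  then have "n < offset L (Suc k)"
    by (simp add: offset_def lessThan_Suc_atMost)
  with assms offset_mono[of "Suc k" i L] show "i \<le> k"
    by (cases "i \<le> k") auto
qed

lemma UN_block:
  assumes "\<And>i. 0 < L i"
  shows "(\<Union>i. block L i) = UNIV"
proof -
  have "n \<in> (\<Union>i. block L i)" for n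
    using in_some_block[of L n] assms by blast
  then show ?thesis by blast
qed

lemma UN_block_atLeast:
  assumes "\<And>i. 0 < L i"
  shows "(\<Union>i\<in>{k..}. block L i) = {offset L k..}"
proof (intro equalityI subsetI)
  fix n assume n: "n \<in> {offset L k..}"
  obtain i where i: "n \<in> block L i"
    using in_some_block[of L n] assms by blast
  have "k \<le> i"
    using n i offset_mono[of "Suc i" k L] by (cases "k \<le> i") auto
  with i show "n \<in> (\<Union>i\<in>{k..}. block L i)" by blast
next
  fix n assume "n \<in> (\<Union>i\<in>{k..}. block L i)"
  then obtain i where "k \<le> i" "n \<in> block L i" by blast
  with offset_mono[of k i L] show "n \<in> {offset L k..}" by simp
qed

lemma infsum_blocks:
  fixes y :: "nat \<Rightarrow> real"
  assumes "y summable_on UNIV" "\<And>i. 0 < L i"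
  shows "infsum y A = (\<Sum>\<^sub>\<infinity>i. sum y (A \<inter> block L i))"
proof -
  have *: "(\<Union>i. A \<inter> block L i) = A"
    using UN_block[of L] assms(2) by blast
  have "infsum y (\<Union>i. A \<inter> block L i) = (\<Sum>\<^sub>\<infinity>i. infsum y (A \<inter> block L i))"
    using assms(1) by (intro infsum_UN_disjoint_family disjoint_family_on_block)
      (auto intro: summable_on_subset_banach)
  then show ?thesis by (simp only: *) simp
qed

section \<open>Density of finite subsums\<close>

text \<open>If no weight exceeds the sum of the later ones by more than \<open>\<epsilon>\<close>, the subsums leave no gap
  longer than \<open>\<epsilon>\<close>.\<close>

lemma digit_sums_dense:
  fixes a :: "nat \<Rightarrow> real" and N :: "nat \<Rightarrow> nat"
  assumes "n \<le> m"
    and pos: "\<And>j. n \<le> j \<Longrightarrow> j < m \<Longrightarrow> 0 < a j"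
    and small: "\<And>j. n \<le> j \<Longrightarrow> j < m \<Longrightarrow> a j \<le> (\<Sum>k=Suc j..<m. real (N k) * a k) + \<epsilon>"
    and t: "0 \<le> t" "t < (\<Sum>j=n..<m. real (N j) * a j)"
  shows "\<exists>d. (\<forall>j. d j \<le> N j) \<and> t < (\<Sum>j=n..<m. real (d j) * a j) \<and>
    (\<Sum>j=n..<m. real (d j) * a j) \<le> t + \<epsilon>"
  using assms
proof (induction n arbitrary: t rule: inc_induct)
  case base
  then show ?case by simp
next
  case (step n)
  let ?S = "\<lambda>d::nat \<Rightarrow> nat. \<Sum>j=Suc n..<m. real (d j) * a j"
  have an: "0 < a n" using step by simp
  have split: "(\<Sum>j=n..<m. real (d j) * a j) = real (d n) * a n + ?S d" for d
    using step.hyps by (simp add: sum.atLeast_Suc_lessThan)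
  \<comment> \<open>Greedy choice: \<open>q\<close> copies of \<open>a n\<close> fit below
    \<open>t\<close>, and \<open>c\<close> caps this at the available multiplicity.\<close>
  define q where "q = nat \<lfloor>t / a n\<rfloor>"
  define c where "c = min (N n) q"
  have q: "real q * a n \<le> t" "t < (real q + 1) * a n"
  proof -
    have "real q = of_int \<lfloor>t / a n\<rfloor>"
      using step.prems an by (simp add: q_def)
    then have "real q \<le> t / a n" "t / a n < real q + 1"
      by linarith+
    then show "real q * a n \<le> t" "t < (real q + 1) * a n"
      using an by (simp_all add: pos_le_divide_eq pos_divide_less_eq)
  qed
  define t' where "t' = t - real c * a n"
  have "real c * a n \<le> real q * a n"
    using an by (simp add: c_def)
  then have t'0: "0 \<le> t'"
    using q by (simp add: t'_def)
  show ?case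
  \<comment> \<open>If the later weights can exceed the remainder \<open>t'\<close>, the induction
    hypothesis finishes. Otherwise \<open>c\<close> was not capped, and one more copy of
    \<open>a n\<close> overshoots \<open>t\<close> by at most \<open>a n - ?S N\<close>, hence by at
    most \<open>\<epsilon>\<close>.\<close>
  proof (cases "t' < ?S N")
    case True
    obtain d where d: "\<forall>j. d j \<le> N j" "t' < ?S d" "?S d \<le> t' + \<epsilon>"
      using step.IH[OF _ _ t'0 True] step.prems by force
    have "?S (d(n := c)) = ?S d"
      by (intro sum.cong) auto
    then show ?thesis
      using d by (intro exI[of _ "d(n := c)"]) (auto simp: split t'_def c_def)
  next
    case False
    have "c \<noteq> N n"
      using False step.prems(4) by (auto simp: split t'_def)
    then have c: "c = q" "c < N n"
      by (auto simp: c_def min_def split: if_splits)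
    let ?d = "\<lambda>j. if j = n then Suc c else 0"
    have "?S ?d = 0"
      by (intro sum.neutral) auto
    then have d: "(\<Sum>j=n..<m. real (?d j) * a j) = (real c + 1) * a n"
      by (simp only: split) simp
    have "a n \<le> ?S N + \<epsilon>"
      using step by simp
    then have "t < (real c + 1) * a n" "(real c + 1) * a n \<le> t + \<epsilon>"
      using False c q by (auto simp: t'_def algebra_simps)
    with c(2) show ?thesis
      by (intro exI[of _ ?d]) (simp only: d, simp)
  qed
qed

section \<open>Complete semi-fast partitions\<close>

definition semi_fast_partitions :: "nat \<Rightarrow> nat list set" where
  "semi_fast_partitions n = {zs. sorted zs \<and> (\<forall>z\<in>set zs. 0 < z) \<and> sum_list zs = n \<and>
     complete_list zs \<and> semi_fast_list zs}"

lemma R_eq_card: "R n = card (semi_fast_partitions n)"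
  by (simp add: R_def semi_fast_partitions_def)

lemma finite_semi_fast_partitions: "finite (semi_fast_partitions n)"
proof (rule finite_subset)
  show "semi_fast_partitions n \<subseteq> {zs. set zs \<subseteq> {..n} \<and> length zs \<le> n}"
  proof
    fix zs assume "zs \<in> semi_fast_partitions n"
    then have zs: "\<forall>z\<in>set zs. 0 < z" "sum_list zs = n"
      by (auto simp: semi_fast_partitions_def)
    have "length zs \<le> sum_list zs" using zs(1)
      by (induction zs) (auto simp: Suc_le_eq add_strict_increasing)
    then show "zs \<in> {zs. set zs \<subseteq> {..n} \<and> length zs \<le> n}"
      using zs(2) by (auto simp: member_le_sum_list)
  qed
qed (simp add: finite_lists_length_le)

text \<open>The partition into ones stands for leaving a block as it is; it is the default element
  in the counting arguments.\<close>

lemma replicate_in_semi_fast_partitions: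
  "replicate n 1 \<in> semi_fast_partitions n"
proof -
  have "\<exists>A. k = (\<Sum>j\<in>A. replicate n (1::nat) ! j) \<and> A \<subseteq> {..<n}" if "k \<le> n" for k
    using that by (intro exI[of _ "{..<k}"]) auto
  moreover have "(\<Sum>j\<in>A. replicate n (1::nat) ! j) \<le> n" if "A \<subseteq> {..<n}" for A
  proof -
    have "(\<Sum>j\<in>A. replicate n (1::nat) ! j) = card A"
      using that by (subst card_eq_sum) (intro sum.cong, auto)
    then show ?thesis
      using card_mono[OF _ that] by simp
  qed
  ultimately have "complete_list (replicate n 1)"
    by (auto simp: complete_list_def sum_list_replicate)
  moreover have "semi_fast_list (replicate n 1)"
    unfolding semi_fast_list_def by (auto intro!: sum.neutral)
  ultimately show ?thesis
    by (simp add: semi_fast_partitions_def sum_list_replicate)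
qed

lemma sum_list_index: "(\<Sum>j<length zs. zs ! j) = sum_list (zs :: nat list)"
  by (simp add: sum_list_sum_nth atLeast0LessThan)

text \<open>The largest part \<open>v\<close>, of multiplicity \<open>m\<close>, is one more than the sum of all smaller parts;
  hence \<open>n + 1 = (m + 1) * v\<close>.\<close>

lemma semi_fast_partitions_prime:
  assumes "prime (n + 1)"
  shows "semi_fast_partitions n = {replicate n 1}"
proof -
  have "zs = replicate n 1" if "zs \<in> semi_fast_partitions n" for zs
  proof -
    let ?l = "length zs"
    have zs: "\<forall>z\<in>set zs. 0 < z" "sum_list zs = n" "complete_list zs" "semi_fast_list zs"
      using that by (auto simp: semi_fast_partitions_def)
    have "n \<noteq> 0" using assms by (metis add_0 not_prime_1)
    then have ne: "set zs \<noteq> {}" using zs(2) by auto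
    define v where "v = Max (set zs)"
    have v: "v \<in> set zs" "\<And>z. z \<in> set zs \<Longrightarrow> z \<le> v"
      using ne by (auto simp: v_def)
    define T where "T = {j. j < ?l \<and> zs ! j = v}"
    define S where "S = {j. j < ?l \<and> zs ! j < v}"
    define s where "s = (\<Sum>j\<in>S. zs ! j)"
    have fin: "finite T" "finite S" by (auto simp: T_def S_def)
    have TS: "{..<?l} = S \<union> T" "S \<inter> T = {}"
      using v(2)[OF nth_mem] by (auto simp: T_def S_def order.order_iff_strict)
    have sumT: "(\<Sum>j\<in>T. zs ! j) = card T * v"
      by (simp add: T_def)
    have n: "n = s + card T * v"
      using zs(2) sum_list_index[of zs] TS fin sumT by (simp add: sum.union_disjoint s_def)
    obtain p where p: "p < ?l" "zs ! p = v"
      using v(1) by (auto simp: in_set_conv_nth)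
    then have T: "card T \<noteq> 0" using fin by (auto simp: T_def)
    have "s < v"
      using zs(4) p unfolding semi_fast_list_def s_def S_def by force
    have "s + 1 \<le> n"
      using n T v(1) zs(1) by (cases "card T") force+
    \<comment> \<open>Completeness makes \<open>s + 1\<close> a subsum. The parts below
      \<open>v\<close> only reach \<open>s\<close>, so a copy of \<open>v\<close> must take part,
      whence \<open>v \<le> s + 1\<close>.\<close>
    then have "s + 1 \<in> {\<Sum>j\<in>A. zs ! j | A. A \<subseteq> {..<?l}}"
      using zs(2,3) by (simp add: complete_list_def)
    then obtain A where A: "A \<subseteq> {..<?l}" "s + 1 = (\<Sum>j\<in>A. zs ! j)"
      by auto
    have "v \<le> s + 1"
    proof (cases "A \<subseteq> S")
      case True
      then have "(\<Sum>j\<in>A. zs ! j) \<le> s"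
        unfolding s_def using fin by (intro sum_mono2) auto
      with A show ?thesis by simp
    next
      case False
      then obtain j where j: "j \<in> A" "zs ! j = v"
        using A(1) TS(1) by (auto simp: T_def)
      have "finite A" using A(1) finite_subset by blast
      then have "zs ! j \<le> (\<Sum>j\<in>A. zs ! j)"
        using j by (intro member_le_sum) auto
      with A j show ?thesis by simp
    qed
    with \<open>s < v\<close> have "v = s + 1" by simp
    then have "n + 1 = (card T + 1) * v"
      using n by simp
    \<comment> \<open>The factor \<open>card T + 1\<close> is at least 2, so primality forces the
      other factor \<open>v\<close> to be 1.\<close>
    with assms T have "v = 1"
      by (metis One_nat_def Suc_eq_plus1 add_is_0 mult.right_neutral nat.inject
          prime_product)
    then have "\<forall>z\<in>set zs. z = 1"
      using v(2) zs(1) by (metis One_nat_def Suc_leI le_antisym)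
    then have "zs = replicate ?l 1"
      by (simp add: replicate_eqI)
    then obtain l where l: "zs = replicate l 1"
      by blast
    then have "l = n"
      using zs(2) by (simp add: sum_list_replicate)
    with l show ?thesis by simp
  qed
  then show ?thesis
    using replicate_in_semi_fast_partitions by blast
qed

text \<open>Completeness is division with remainder by \<open>a\<close>. The ones add up to
  \<open>a - 1 < a\<close>, which is the semi-fast condition.\<close>

lemma semi_fast_partitions_product:
  assumes "n + 1 = a * b" "2 \<le> a" "2 \<le> b"
  shows "replicate (a - 1) 1 @ replicate (b - 1) a \<in> semi_fast_partitions n"
proof -
  let ?zs = "replicate (a - 1) 1 @ replicate (b - 1) a"
  have nth: "?zs ! j = (if j < a - 1 then 1 else a)" if "j < length ?zs" for j
    using that by (auto simp: nth_append)
  have len: "length ?zs = (a - 1) + (b - 1)" by simp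
  have sum: "sum_list ?zs = n"
  proof -
    have "sum_list ?zs = (a - 1) + (b - 1) * a"
      by (simp add: sum_list_replicate)
    also have "\<dots> = n"
      using assms by (cases a; cases b) (auto simp: algebra_simps)
    finally show ?thesis .
  qed
  have "\<exists>A. k = (\<Sum>j\<in>A. ?zs ! j) \<and> A \<subseteq> {..<length ?zs}" if k: "k \<le> n" for k
  proof -
    \<comment> \<open>This takes \<open>k mod a\<close> of the ones and \<open>k div a\<close>
      copies of \<open>a\<close>, which begin at index \<open>a - 1\<close>.\<close>
    let ?A = "{..<k mod a} \<union> {a - 1..<a - 1 + k div a}"
    have "k < a * b" using k assms(1) by simp
    then have "k div a < b" using assms(2) by (simp add: less_mult_imp_div_less mult.commute)
    moreover have "k mod a \<le> a - 1"
      using assms(2) by (simp add: Suc_leI less_Suc_eq_le[symmetric])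
    ultimately have sub: "?A \<subseteq> {..<length ?zs}" and disj: "{..<k mod a} \<inter> {a - 1..<a - 1 + k div a} = {}"
      unfolding len by auto
    have "(\<Sum>j\<in>?A. ?zs ! j) = (\<Sum>j<k mod a. ?zs ! j) + (\<Sum>j=a - 1..<a - 1 + k div a. ?zs ! j)"
      using disj by (intro sum.union_disjoint) auto
    also have "(\<Sum>j<k mod a. ?zs ! j) = (\<Sum>j<k mod a. 1)"
      using \<open>k mod a \<le> a - 1\<close> sub by (intro sum.cong refl) (subst nth, auto)
    also have "(\<Sum>j=a - 1..<a - 1 + k div a. ?zs ! j) = (\<Sum>j=a - 1..<a - 1 + k div a. a)"
      using sub by (intro sum.cong refl) (subst nth, auto)
    finally have "(\<Sum>j\<in>?A. ?zs ! j) = k"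
      by simp
    then show ?thesis using sub by metis
  qed
  moreover have "(\<Sum>j\<in>A. ?zs ! j) \<le> n" if "A \<subseteq> {..<length ?zs}" for A
  proof -
    have "(\<Sum>j\<in>A. ?zs ! j) \<le> (\<Sum>j<length ?zs. ?zs ! j)"
      using that by (intro sum_mono2) auto
    then show ?thesis by (simp only: sum_list_index sum)
  qed
  ultimately have "complete_list ?zs"
    unfolding complete_list_def sum by auto
  moreover have "semi_fast_list ?zs"
    unfolding semi_fast_list_def
  proof (intro allI impI)
    fix p assume p: "p < length ?zs"
    define Z where "Z = {j. j < length ?zs \<and> ?zs ! j < ?zs ! p}"
    have "(\<Sum>j\<in>Z. ?zs ! j) < ?zs ! p"
    proof (cases "p < a - 1")
      case True
      have "\<not> ?zs ! j < ?zs ! p" if "j < length ?zs" for j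
        unfolding nth[OF that] nth[OF p] using True assms(2) by simp
      then have "Z = {}" by (auto simp only: Z_def)
      then show ?thesis
        unfolding nth[OF p] using True by simp
    next
      case False
      have Z: "j < a - 1 \<and> ?zs ! j = 1" if "j \<in> Z" for j
      proof -
        have j: "j < length ?zs" "?zs ! j < ?zs ! p" using that by (simp_all only: Z_def mem_Collect_eq)
        from j(2) show ?thesis
          unfolding nth[OF j(1)] nth[OF p] using False by (cases "j < a - 1") simp_all
      qed
      have "(\<Sum>j\<in>Z. ?zs ! j) = card Z"
        using Z by (subst card_eq_sum) (intro sum.cong refl, blast)
      also have "\<dots> \<le> card {..<a - 1}"
        using Z by (intro card_mono) blast+
      also have "\<dots> < ?zs ! p"
        unfolding nth[OF p] using False assms(2) by simp
      finally show ?thesis .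
    qed
    then show "(\<Sum>j | j < length ?zs \<and> ?zs ! j < ?zs ! p. ?zs ! j) < ?zs ! p"
      by (simp only: Z_def)
  qed
  ultimately show ?thesis
    using sum assms by (auto simp: semi_fast_partitions_def sorted_append)
qed

lemma semi_fast_partitions_not_prime:
  assumes "\<not> prime (n + 1)" "0 < n"
  shows "\<exists>zs\<in>semi_fast_partitions n. zs \<noteq> replicate n 1"
proof -
  from assms obtain a where a: "a dvd n + 1" "a \<noteq> 1" "a \<noteq> n + 1"
    by (auto simp: prime_nat_iff)
  then obtain b where b: "n + 1 = a * b" by (auto simp: dvd_def)
  have "a \<noteq> 0" "b \<noteq> 0" "b \<noteq> 1"
    using a b by (metis add_is_0 mult_is_0 mult.right_neutral one_neq_zero)+
  then have ab: "2 \<le> a" "2 \<le> b" using a by auto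
  let ?zs = "replicate (a - 1) 1 @ replicate (b - 1) a"
  have "a \<in> set ?zs" using ab by auto
  then have "?zs \<noteq> replicate n 1"
    using a(2) by (metis in_set_replicate)
  with semi_fast_partitions_product[OF b ab] show ?thesis by blast
qed

text \<open>Positivity excludes \<open>n = 0\<close>, where the empty list is the only partition
  although 1 is not prime.\<close>

lemma R_eq_1_iff:
  assumes "0 < n"
  shows "R n = 1 \<longleftrightarrow> prime (n + 1)"
proof
  assume "R n = 1"
  then obtain x where x: "semi_fast_partitions n = {x}"
    unfolding R_eq_card by (metis card_1_singletonE)
  show "prime (n + 1)"
  proof (rule ccontr)
    assume "\<not> prime (n + 1)"
    from semi_fast_partitions_not_prime[OF this assms] x replicate_in_semi_fast_partitions[of n]
    show False by auto
  qed
next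
  assume "prime (n + 1)"
  then show "R n = 1"
    using semi_fast_partitions_prime by (simp add: R_eq_card)
qed

section \<open>Partitions read as functions on an interval of indices\<close>

lemma sum_list_rev_map_upt: "sum_list (rev (map c [a..<b])) = sum c {a..<b}" for c :: "nat \<Rightarrow> nat"
  by (simp flip: sum_set_upt_conv_sum_list_nat)

lemma bij_betw_rev_upt: "bij_betw (\<lambda>j. b - Suc j) {..<b - a} {a..<b}"
  by (rule bij_betwI[where g = "\<lambda>k. b - Suc k"]) auto

lemma nth_rev_map_upt: "j < b - a \<Longrightarrow> rev (map c [a..<b]) ! j = c (b - Suc j)"
  by (simp add: rev_nth)

text \<open>Representations are non-increasing but partitions are listed in non-decreasing order,
  hence \<open>rev\<close>. The reflection \<open>b - Suc j\<close> carries list positions to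
  indices, so each condition can be checked on \<open>c\<close> directly.\<close>

lemma semi_fast_partitions_iff:
  fixes c :: "nat \<Rightarrow> nat"
  shows "rev (map c [a..<b]) \<in> semi_fast_partitions n \<longleftrightarrow>
    (\<forall>p q. a \<le> p \<longrightarrow> p \<le> q \<longrightarrow> q < b \<longrightarrow> c q \<le> c p) \<and> (\<forall>p\<in>{a..<b}. 0 < c p) \<and> sum c {a..<b} = n \<and>
    {sum c A | A. A \<subseteq> {a..<b}} = {0..n} \<and>
    (\<forall>p\<in>{a..<b}. (\<Sum>q | q \<in> {a..<b} \<and> c q < c p. c q) < c p)"
proof -
  let ?zs = "rev (map c [a..<b])"
  let ?h = "\<lambda>j. b - Suc j"
  have len: "length ?zs = b - a" by simp
  have bij: "bij_betw ?h {..<b - a} {a..<b}" by (rule bij_betw_rev_upt)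
  have sum: "(\<Sum>j\<in>A. ?zs ! j) = sum c (?h ` A)" if "A \<subseteq> {..<b - a}" for A
  proof -
    have "inj_on ?h A" using bij that by (metis bij_betw_def inj_on_subset)
    then have "sum c (?h ` A) = (\<Sum>j\<in>A. c (?h j))" by (simp add: sum.reindex)
    also have "\<dots> = (\<Sum>j\<in>A. ?zs ! j)"
      using that by (intro sum.cong refl nth_rev_map_upt[symmetric]) auto
    finally show ?thesis by simp
  qed
  have "{\<Sum>j\<in>A. ?zs ! j | A. A \<subseteq> {..<b - a}} = {sum c A | A. A \<subseteq> {a..<b}}"
  proof (intro equalityI subsetI)
    fix s assume "s \<in> {\<Sum>j\<in>A. ?zs ! j | A. A \<subseteq> {..<b - a}}"
    then obtain A where "A \<subseteq> {..<b - a}" "s = (\<Sum>j\<in>A. ?zs ! j)" by blast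
    with sum[of A] bij show "s \<in> {sum c A | A. A \<subseteq> {a..<b}}"
      by (auto simp: bij_betw_def intro!: exI[of _ "?h ` A"])
  next
    fix s assume "s \<in> {sum c A | A. A \<subseteq> {a..<b}}"
    then obtain B where B: "B \<subseteq> {a..<b}" "s = sum c B" by blast
    then obtain A where "A \<subseteq> {..<b - a}" "B = ?h ` A"
      using bij by (metis bij_betw_imp_surj_on subset_image_iff)
    with sum[of A] B show "s \<in> {\<Sum>j\<in>A. ?zs ! j | A. A \<subseteq> {..<b - a}}" by force
  qed
  then have complete: "complete_list ?zs \<longleftrightarrow> {sum c A | A. A \<subseteq> {a..<b}} = {0..sum c {a..<b}}"
    unfolding complete_list_def len sum_list_rev_map_upt by simp
  have "(\<Sum>j | j < b - a \<and> ?zs ! j < ?zs ! p. ?zs ! j) = (\<Sum>q | q \<in> {a..<b} \<and> c q < c (?h p). c q)"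
    if p: "p < b - a" for p
  proof -
    have "?h ` {j. j < b - a \<and> ?zs ! j < ?zs ! p} = ?h ` {j \<in> {..<b - a}. c (?h j) < c (?h p)}"
      using p by (intro arg_cong[of _ _ "\<lambda>A. ?h ` A"]) (auto simp: nth_rev_map_upt)
    also have "\<dots> = {q \<in> ?h ` {..<b - a}. c q < c (?h p)}" by blast
    also have "\<dots> = {q. q \<in> {a..<b} \<and> c q < c (?h p)}"
      using bij by (simp only: bij_betw_def)
    finally show ?thesis
      by (subst sum) auto
  qed
  then have "semi_fast_list ?zs \<longleftrightarrow>
      (\<forall>p\<in>{..<b - a}. (\<Sum>q | q \<in> {a..<b} \<and> c q < c (?h p). c q) < c (?h p))"
    unfolding semi_fast_list_def len by (auto simp: nth_rev_map_upt)
  also have "\<dots> \<longleftrightarrow> (\<forall>p\<in>?h ` {..<b - a}. (\<Sum>q | q \<in> {a..<b} \<and> c q < c p. c q) < c p)"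
    by (simp only: ball_simps)
  also have "?h ` {..<b - a} = {a..<b}" using bij by (simp only: bij_betw_def)
  finally have fast: "semi_fast_list ?zs \<longleftrightarrow>
      (\<forall>p\<in>{a..<b}. (\<Sum>q | q \<in> {a..<b} \<and> c q < c p. c q) < c p)" .
  have "sorted ?zs \<longleftrightarrow> (\<forall>p q. a \<le> p \<longrightarrow> p \<le> q \<longrightarrow> q < b \<longrightarrow> c q \<le> c p)"
  proof
    assume s: "sorted ?zs"
    show "\<forall>p q. a \<le> p \<longrightarrow> p \<le> q \<longrightarrow> q < b \<longrightarrow> c q \<le> c p"
    proof (intro allI impI)
      fix p q assume "a \<le> p" "p \<le> q" "q < b"
      with sorted_nth_mono[OF s, of "?h q" "?h p"] show "c q \<le> c p"
        by (simp add: nth_rev_map_upt del: rev_map)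
    qed
  next
    assume mono: "\<forall>p q. a \<le> p \<longrightarrow> p \<le> q \<longrightarrow> q < b \<longrightarrow> c q \<le> c p"
    show "sorted ?zs"
      unfolding sorted_iff_nth_mono len
      by (intro allI impI) (use mono in \<open>simp add: nth_rev_map_upt del: rev_map\<close>)
  qed
  then show ?thesis
    unfolding semi_fast_partitions_def mem_Collect_eq complete fast sum_list_rev_map_upt by auto
qed

lemma rev_map_upt_nth_rev:
  assumes "length zs = b - a"
  shows "rev (map (\<lambda>n. rev zs ! (n - a)) [a..<b]) = zs"
  using assms by (intro nth_equalityI) (auto simp: rev_nth)

section \<open>Digit sums and their gaps\<close>

locale gapped_blocks =
  fixes \<alpha> :: "nat \<Rightarrow> real" and N :: "nat \<Rightarrow> nat"
  assumes alpha_pos: "0 < \<alpha> i"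
    and N_pos: "0 < N i"
    and summable_terms: "(\<lambda>i. real (N i) * \<alpha> i) summable_on UNIV"
    and fast: "(\<Sum>\<^sub>\<infinity>j\<in>{Suc i..}. real (N j) * \<alpha> j) < \<alpha> i"
    and gap: "(real (N (Suc i)) + 1) * \<alpha> (Suc i) < \<alpha> i"
begin

text \<open>The sum starts at \<open>i\<close> itself, so the \<open>r\<^sub>i\<close> of the
  overview is \<open>tail (Suc i)\<close>.\<close>

definition tail :: "nat \<Rightarrow> real" where
  "tail i = (\<Sum>\<^sub>\<infinity>j\<in>{i..}. real (N j) * \<alpha> j)"

definition digit_sums :: "real set" where
  "digit_sums = {\<Sum>\<^sub>\<infinity>i. real (d i) * \<alpha> i | d. \<forall>i. d i \<le> N i}"

lemma digit_nonneg: "0 \<le> real n * \<alpha> i"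
  using alpha_pos[of i] by simp

lemma digit_mono: "m \<le> n \<Longrightarrow> real m * \<alpha> i \<le> real n * \<alpha> i"
  using alpha_pos[of i] by simp

lemma summable_digits:
  assumes "\<And>i. d i \<le> N i"
  shows "(\<lambda>i. real (d i) * \<alpha> i) summable_on A"
proof (rule summable_on_comparison_test)
  show "(\<lambda>i. real (N i) * \<alpha> i) summable_on A"
    using summable_terms by (rule summable_on_subset_banach) simp
qed (simp_all add: assms digit_mono digit_nonneg)

lemma tail_nonneg: "0 \<le> tail i"
  unfolding tail_def by (intro infsum_nonneg digit_nonneg)

lemma infsum_digits_Suc:
  assumes "\<And>i. d i \<le> N i"
  shows "(\<Sum>\<^sub>\<infinity>j\<in>{i..}. real (d j) * \<alpha> j) = real (d i) * \<alpha> i + (\<Sum>\<^sub>\<infinity>j\<in>{Suc i..}. real (d j) * \<alpha> j)"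
  using infsum_atLeast_split[of "\<lambda>j. real (d j) * \<alpha> j" i "Suc i"] summable_digits[OF assms] by simp

lemma tail_Suc: "tail i = real (N i) * \<alpha> i + tail (Suc i)"
  unfolding tail_def by (rule infsum_digits_Suc) simp

lemma tail_less: "tail (Suc i) < \<alpha> i"
  using fast by (simp add: tail_def)

lemma alpha_le_tail: "\<alpha> i \<le> tail i"
proof -
  have "1 * \<alpha> i \<le> real (N i) * \<alpha> i"
    using N_pos[of i] alpha_pos[of i] by (intro mult_right_mono) auto
  then show ?thesis using tail_Suc[of i] tail_nonneg[of "Suc i"] by simp
qed

lemma tail_pos: "0 < tail i"
  using alpha_le_tail[of i] alpha_pos[of i] by simp

lemma tail_Suc_less: "tail (Suc i) < tail i"
  using tail_less[of i] alpha_le_tail[of i] by simp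

lemma tail_antimono: "i \<le> j \<Longrightarrow> tail j \<le> tail i"
  by (rule lift_Suc_antimono_le[of tail]) (rule less_imp_le[OF tail_Suc_less])

lemma tail_less_alpha: "i < j \<Longrightarrow> tail j < \<alpha> i"
  using tail_antimono[of "Suc i" j] tail_less[of i] by simp

lemma digit_sum_le_tail:
  assumes "\<And>i. d i \<le> N i"
  shows "(\<Sum>\<^sub>\<infinity>j\<in>{i..}. real (d j) * \<alpha> j) \<le> tail i"
  unfolding tail_def using assms by (intro infsum_mono summable_digits digit_mono) auto

text \<open>Since \<open>tail i < \<alpha> j\<close> for \<open>j < i\<close>, a digit sum of at
  most \<open>tail i\<close> has only zero digits before position \<open>i\<close>; \<open>c\<close>
  is its digit at \<open>i\<close>.\<close>

lemma digit_sum_split: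
  assumes "v \<in> digit_sums" "v \<le> tail i"
  obtains c e where "c \<le> N i" "0 \<le> e" "e \<le> tail (Suc i)" "v = real c * \<alpha> i + e"
proof -
  obtain d where d: "\<And>i. d i \<le> N i" and v: "v = (\<Sum>\<^sub>\<infinity>i. real (d i) * \<alpha> i)"
    using assms(1) by (auto simp: digit_sums_def)
  have "d j = 0" if "j < i" for j
  proof (rule ccontr)
    assume "d j \<noteq> 0"
    have "1 * \<alpha> j \<le> real (d j) * \<alpha> j"
      using \<open>d j \<noteq> 0\<close> alpha_pos[of j] by (intro mult_right_mono) auto
    also have "\<dots> \<le> v"
      using finite_sum_le_infsum[of "\<lambda>j. real (d j) * \<alpha> j" UNIV "{j}"] summable_digits[OF d]
      by (simp add: v digit_nonneg)
    finally show False
      using assms(2) tail_less_alpha[OF that] by simp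
  qed
  then have "v = (\<Sum>\<^sub>\<infinity>j\<in>{i..}. real (d j) * \<alpha> j)"
    unfolding v by (intro infsum_cong_neutral) auto
  then have "v = real (d i) * \<alpha> i + (\<Sum>\<^sub>\<infinity>j\<in>{Suc i..}. real (d j) * \<alpha> j)"
    using infsum_digits_Suc[of d i, OF d] by simp
  moreover have "0 \<le> (\<Sum>\<^sub>\<infinity>j\<in>{Suc i..}. real (d j) * \<alpha> j)"
    by (intro infsum_nonneg digit_nonneg)
  ultimately show ?thesis
    using that d digit_sum_le_tail[of d, OF d] by blast
qed

lemma digit_sum_le_tail_0: "v \<in> digit_sums \<Longrightarrow> v \<le> tail 0"
  unfolding digit_sums_def using digit_sum_le_tail[of _ 0] by (force simp: atLeast_0)

lemma finite_digit_sum_in: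
  assumes "finite F" "\<And>i. i \<in> F \<Longrightarrow> d i \<le> N i"
  shows "(\<Sum>i\<in>F. real (d i) * \<alpha> i) \<in> digit_sums"
proof -
  let ?d = "\<lambda>i. if i \<in> F then d i else 0"
  have "(\<Sum>\<^sub>\<infinity>i. real (?d i) * \<alpha> i) = (\<Sum>\<^sub>\<infinity>i\<in>F. real (d i) * \<alpha> i)"
    by (intro infsum_cong_neutral) auto
  also have "\<dots> = (\<Sum>i\<in>F. real (d i) * \<alpha> i)"
    using assms(1) by simp
  finally show ?thesis
    unfolding digit_sums_def using assms(2) by (intro CollectI exI[of _ ?d]) auto
qed

lemma multiple_in_digit_sums: "c \<le> N i \<Longrightarrow> real c * \<alpha> i \<in> digit_sums"
  using finite_digit_sum_in[of "{i}" "\<lambda>_. c"] by simp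

lemma tail_in_digit_sums: "tail i \<in> digit_sums"
proof -
  have "(\<Sum>\<^sub>\<infinity>j. real (if i \<le> j then N j else 0) * \<alpha> j) = tail i"
    unfolding tail_def by (intro infsum_cong_neutral) auto
  then show ?thesis
    unfolding digit_sums_def by (intro CollectI exI[of _ "\<lambda>j. if i \<le> j then N j else 0"]) auto
qed

text \<open>The digit at \<open>i\<close> is an integer and the later digits contribute at most
  \<open>tail (Suc i)\<close>, so exceeding the lower end of the gap forces this digit up to at
  least \<open>c + 1\<close>.\<close>

lemma digit_sum_no_gap_point:
  assumes "v \<in> digit_sums" "v \<le> tail i" "real c * \<alpha> i + tail (Suc i) < v"
  shows "(real c + 1) * \<alpha> i \<le> v"
proof -
  obtain c' e where *: "0 \<le> e" "e \<le> tail (Suc i)" "v = real c' * \<alpha> i + e"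
    using digit_sum_split[OF assms(1,2)] by metis
  have "real c * \<alpha> i < real c' * \<alpha> i"
    using * assms(3) by simp
  then have "c < c'" using alpha_pos[of i] by simp
  then have "(real c + 1) * \<alpha> i \<le> real c' * \<alpha> i"
    using alpha_pos[of i] by (intro mult_right_mono) auto
  with * show ?thesis by simp
qed

lemma digit_sum_le_tail_Suc:
  assumes "v \<in> digit_sums" "v < \<alpha> i"
  shows "v \<le> tail (Suc i)"
proof (rule ccontr)
  assume "\<not> v \<le> tail (Suc i)"
  with digit_sum_no_gap_point[of v i 0] assms alpha_le_tail[of i] show False by simp
qed

section \<open>Comparison of gap lengths\<close>

definition gap_length :: "nat \<Rightarrow> real" where
  "gap_length i = \<alpha> i - tail (Suc i)"

text \<open>This is the hypothesis \<open>gap\<close> rewritten by \<open>tail_Suc\<close>.\<close>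

lemma gap_length_Suc: "gap_length (Suc i) < gap_length i"
  using gap[of i] tail_Suc[of "Suc i"] by (simp add: gap_length_def algebra_simps)

lemma gap_length_antimono: "i \<le> j \<Longrightarrow> gap_length j \<le> gap_length i"
  by (rule lift_Suc_antimono_le[of gap_length]) (rule less_imp_le[OF gap_length_Suc])

lemma tail_split:
  assumes "n \<le> m"
  shows "tail n = (\<Sum>j=n..<m. real (N j) * \<alpha> j) + tail m"
  using infsum_atLeast_split[OF summable_terms assms] by (simp only: tail_def)

lemma digit_sums_dense_tail:
  assumes "0 \<le> t" "t < tail i" "gap_length i < \<epsilon>"
  obtains v where "v \<in> digit_sums" "t < v" "v \<le> t + \<epsilon>"
proof -
  \<comment> \<open>Room for cutting the sum off at \<open>m\<close>: the first bound keeps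
    \<open>t\<close> below the truncated total, the second fits \<open>tail m\<close> into the slack
    \<open>\<epsilon> - gap_length i\<close>.\<close>
  let ?e = "min (tail i - t) (\<epsilon> - gap_length i)"
  obtain m where m: "i \<le> m" "tail m < ?e"
    using infsum_atLeast_small[OF summable_terms, of ?e] assms
    unfolding tail_def[symmetric] by (metis diff_gt_0_iff_gt min_less_iff_conj)
  have small: "\<alpha> j \<le> (\<Sum>k=Suc j..<m. real (N k) * \<alpha> k) + \<epsilon>" if "i \<le> j" "j < m" for j
    using gap_length_antimono[OF that(1)] tail_split[of "Suc j" m] that m
    by (simp add: gap_length_def)
  obtain d where d: "\<forall>j. d j \<le> N j" "t < (\<Sum>j=i..<m. real (d j) * \<alpha> j)"
      "(\<Sum>j=i..<m. real (d j) * \<alpha> j) \<le> t + \<epsilon>"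
    using digit_sums_dense[OF m(1) alpha_pos small assms(1)] tail_split[OF m(1)] m(2) by force
  show ?thesis
    using d by (intro that[OF finite_digit_sum_in]) auto
qed

end

section \<open>Arbitrary semi-fast representations\<close>

text \<open>\<open>digit_sums\<close> is the achievement set of the block sequence; \<open>y\<close> is an arbitrary
  representation of it.\<close>

locale digit_sums_representation = gapped_blocks +
  fixes y :: "nat \<Rightarrow> real"
  assumes sf: "semi_fast_convergent y" and ach: "achievement_set y = digit_sums"
begin

lemma y_dec: "i \<le> j \<Longrightarrow> y j \<le> y i"
  using sf by (auto simp: semi_fast_convergent_def admissible_seq_def decseq_def)

lemma y_pos: "0 < y n"
  using sf by (auto simp: semi_fast_convergent_def admissible_seq_def)

lemma y_nonneg: "0 \<le> y n"
  using y_pos by (rule less_imp_le)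

lemma y_summable: "y summable_on A"
proof -
  have "summable y"
    using sf by (auto simp: semi_fast_convergent_def admissible_seq_def)
  then have "y summable_on UNIV"
    by (intro summable_nonneg_imp_summable_on y_nonneg)
  then show ?thesis by (rule summable_on_subset_banach) simp
qed

lemma y_fast: "infsum y {k. y k < y n} < y n"
  using sf by (simp add: semi_fast_convergent_def)

lemma infsum_y_mono: "A \<subseteq> B \<Longrightarrow> infsum y A \<le> infsum y B"
  by (intro infsum_mono2 y_summable y_nonneg)

lemma y_le_infsum: "n \<in> A \<Longrightarrow> y n \<le> infsum y A"
  using infsum_y_mono[of "{n}" A] by simp

lemma infsum_y_in: "infsum y A \<in> digit_sums"
  using ach by (auto simp: achievement_set_def)

lemma digit_sumsE:
  assumes "v \<in> digit_sums"
  obtains A where "v = infsum y A"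
  using assms ach by (auto simp: achievement_set_def)

lemma y_in: "y n \<in> digit_sums"
  using infsum_y_in[of "{n}"] by simp

text \<open>A subsum smaller than \<open>y n\<close> can only use terms smaller than
  \<open>y n\<close>. So no digit sum lies strictly between their total and
  \<open>y n\<close>.\<close>

lemma gap_below_y:
  assumes "v \<in> digit_sums" "v < y n"
  shows "v \<le> infsum y {k. y k < y n}"
proof -
  obtain A where A: "v = infsum y A" using assms(1) by (rule digit_sumsE)
  then have "A \<subseteq> {k. y k < y n}"
    using y_le_infsum[of _ A] assms(2) by force
  then show ?thesis using infsum_y_mono A by simp
qed

section \<open>Final segments of a representation\<close>

definition start :: "nat \<Rightarrow> nat" where
  "start i = (LEAST k. y k \<le> tail i)"

text \<open>\<open>y\<close> tends to 0 and \<open>tail i\<close> is positive, so the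
  \<open>LEAST\<close> exists; monotonicity turns the terms of size at most \<open>tail i\<close>
  into a final segment.\<close>

lemma y_le_tail_iff: "y k \<le> tail i \<longleftrightarrow> start i \<le> k"
proof -
  have "y \<longlonglongrightarrow> 0"
    using y_summable[of UNIV] by (intro summable_LIMSEQ_zero summable_on_imp_summable)
  then have "\<forall>\<^sub>F k in sequentially. y k < tail i"
    using tail_pos[of i] by (intro order_tendstoD)
  then have "\<exists>k. y k \<le> tail i"
    by (auto simp: eventually_sequentially intro: less_imp_le)
  then have "y (start i) \<le> tail i"
    unfolding start_def by (rule LeastI_ex)
  then show ?thesis
    using y_dec[of "start i" k] not_less_Least[of k "\<lambda>k. y k \<le> tail i"]
    by (fold start_def) (cases "start i \<le> k"; auto)
qed

text \<open>The terms from \<open>start i\<close> on are tied to \<open>gap_length i\<close>, since below each of them lies a gap of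
  the achievement set contained in \<open>[0, tail i]\<close>.\<close>

lemma y_dense:
  assumes t: "0 \<le> t" "t < infsum y {start i..}" and eps: "gap_length i < \<epsilon>"
  obtains A where "A \<subseteq> {start i..}" "t < infsum y A" "infsum y A \<le> t + \<epsilon>"
proof -
  let ?s = "start i"
  \<comment> \<open>This splits the slack: the density of the digit sums requires more than
    \<open>gap_length i\<close>, and \<open>\<epsilon> - \<epsilon>'\<close> pays for the terms cut
    off at \<open>m\<close>.\<close>
  define \<epsilon>' where "\<epsilon>' = (gap_length i + \<epsilon>) / 2"
  have \<epsilon>': "gap_length i < \<epsilon>'" "\<epsilon>' < \<epsilon>" using eps by (auto simp: \<epsilon>'_def field_simps)
  let ?e = "min (infsum y {?s..} - t) (\<epsilon> - \<epsilon>')"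
  obtain m where m: "?s \<le> m" "infsum y {m..} < ?e"
    using infsum_atLeast_small[OF y_summable, of ?e] t \<epsilon>'
    by (metis diff_gt_0_iff_gt min_less_iff_conj)
  have small: "y j \<le> (\<Sum>k=Suc j..<m. real 1 * y k) + \<epsilon>" if j: "?s \<le> j" "j < m" for j
  proof -
    let ?\<sigma> = "infsum y {k. y k < y j}"
    have "0 \<le> ?\<sigma>" by (intro infsum_nonneg y_nonneg)
    moreover have "?\<sigma> < tail i"
      using y_fast[of j] y_le_tail_iff[of j i] j by simp
    ultimately obtain v where v: "v \<in> digit_sums" "?\<sigma> < v" "v \<le> ?\<sigma> + \<epsilon>'"
      using digit_sums_dense_tail[of ?\<sigma> i \<epsilon>'] \<epsilon>' by metis
    \<comment> \<open>The digit sum \<open>v\<close> exceeds the total of the terms below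
      \<open>y j\<close>, so it cannot be below \<open>y j\<close> itself. Hence
      \<open>y j \<le> ?\<sigma> + \<epsilon>'\<close>.\<close>
    have "\<not> v < y j" using gap_below_y[OF v(1)] v(2) by force
    moreover have "?\<sigma> \<le> infsum y {Suc j..}"
    proof (rule infsum_y_mono)
      show "{k. y k < y j} \<subseteq> {Suc j..}"
        using y_dec by (auto simp: Suc_le_eq) (metis linorder_not_less)
    qed
    moreover have "infsum y {Suc j..} = sum y {Suc j..<m} + infsum y {m..}"
      using j by (intro infsum_atLeast_split y_summable) simp
    ultimately show ?thesis using v m by simp
  qed
  have total: "infsum y {?s..} = (\<Sum>j=?s..<m. real 1 * y j) + infsum y {m..}"
    using infsum_atLeast_split[OF y_summable m(1)] by simp
  then have "t < (\<Sum>j=?s..<m. real 1 * y j)"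
    using m(2) by simp
  \<comment> \<open>All multiplicities are 1 here, so choosing digits means choosing a subset of the
    indices.\<close>
  from digit_sums_dense[OF m(1) y_pos small t(1) this]
  obtain d :: "nat \<Rightarrow> nat" where d: "\<forall>j. d j \<le> 1" "t < (\<Sum>j=?s..<m. real (d j) * y j)"
      "(\<Sum>j=?s..<m. real (d j) * y j) \<le> t + \<epsilon>"
    by blast
  let ?A = "{j \<in> {?s..<m}. d j = 1}"
  have "(\<Sum>j=?s..<m. real (d j) * y j) = (\<Sum>j=?s..<m. if d j = 1 then y j else 0)"
  proof (rule sum.cong)
    fix j show "real (d j) * y j = (if d j = 1 then y j else 0)"
      using d(1) by (cases "d j = 1") (auto simp: le_Suc_eq)
  qed simp
  also have "\<dots> = sum y ?A"
    by (rule sum.inter_filter[symmetric]) simp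
  also have "\<dots> = infsum y ?A" by simp
  finally show ?thesis
    using d by (intro that[of ?A]) auto
qed

text \<open>The gap \<open>(tail (Suc i), \<alpha> i)\<close> is longer than every gap to its left, so the terms of \<open>y\<close> below it
  cannot add up to more than \<open>tail (Suc i)\<close> without hitting it.\<close>

lemma infsum_start: "infsum y {start i..} = tail i"
proof (cases i)
  case 0
  have "start 0 \<le> k" for k
    using digit_sum_le_tail_0[OF y_in] y_le_tail_iff by blast
  then have "{start 0..} = UNIV" by auto
  moreover obtain A where "tail 0 = infsum y A"
    using tail_in_digit_sums by (rule digit_sumsE)
  ultimately show ?thesis
    using digit_sum_le_tail_0[OF infsum_y_in] infsum_y_mono[of A UNIV] 0 by (simp add: order_antisym)
next
  case (Suc j)
  obtain A where A: "tail i = infsum y A"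
    using tail_in_digit_sums by (rule digit_sumsE)
  then have "A \<subseteq> {start i..}"
    using y_le_infsum[of _ A] by (auto simp flip: y_le_tail_iff)
  then have "tail i \<le> infsum y {start i..}"
    using A infsum_y_mono by simp
  moreover have "\<not> tail i < infsum y {start i..}"
  proof
    assume less: "tail i < infsum y {start i..}"
    \<comment> \<open>Above \<open>gap_length i\<close> for density, below
      \<open>gap_length j\<close> so that the step past \<open>tail i\<close> ends inside the gap
      below \<open>\<alpha> j\<close>.\<close>
    define \<epsilon> where "\<epsilon> = (gap_length i + gap_length j) / 2"
    have \<epsilon>: "gap_length i < \<epsilon>" "\<epsilon> < gap_length j"
      using gap_length_Suc[of j] Suc by (auto simp: \<epsilon>_def)
    obtain B where B: "tail i < infsum y B" "infsum y B \<le> tail i + \<epsilon>"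
      using y_dense[OF tail_nonneg less \<epsilon>(1)] by metis
    then have "infsum y B < \<alpha> j" using \<epsilon> Suc by (simp add: gap_length_def)
    then show False
      using digit_sum_le_tail_Suc[OF infsum_y_in] B Suc by force
  qed
  ultimately show ?thesis by simp
qed

text \<open>If \<open>e > 0\<close>, adding suitable smaller terms to \<open>y k\<close> would land in the gap
  \<open>(c * \<alpha> i + tail (Suc i), (c + 1) * \<alpha> i)\<close>.\<close>

lemma y_multiple:
  assumes "start i \<le> k" "k < start (Suc i)"
  obtains c where "y k = real c * \<alpha> i"
proof -
  have "y k \<le> tail i" using assms y_le_tail_iff by simp
  then obtain c e where e: "0 \<le> e" "e \<le> tail (Suc i)" "y k = real c * \<alpha> i + e"
    using digit_sum_split[OF y_in] by metis
  have "e = 0"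
  proof (rule ccontr)
    assume "e \<noteq> 0"
    define \<epsilon> where "\<epsilon> = (gap_length (Suc i) + gap_length i) / 2"
    have \<epsilon>: "gap_length (Suc i) < \<epsilon>" "\<epsilon> < gap_length i"
      using gap_length_Suc[of i] by (auto simp: \<epsilon>_def)
    \<comment> \<open>With this target, \<open>y k\<close> plus a subsum just above it exceeds
      \<open>c * \<alpha> i + tail (Suc i)\<close> by at most \<open>\<epsilon>\<close>, less than
      the gap length.\<close>
    have "0 \<le> tail (Suc i) - e" "tail (Suc i) - e < infsum y {start (Suc i)..}"
      using e \<open>e \<noteq> 0\<close> by (auto simp: infsum_start)
    from y_dense[OF this \<epsilon>(1)] obtain A where A: "A \<subseteq> {start (Suc i)..}"
        "tail (Suc i) - e < infsum y A" "infsum y A \<le> tail (Suc i) - e + \<epsilon>"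
      by metis
    have "k \<notin> A" using A(1) assms by auto
    then have v: "infsum y (insert k A) = y k + infsum y A"
      by (intro infsum_insert y_summable)
    have "insert k A \<subseteq> {start i..}"
      using A(1) assms by auto
    then have "infsum y (insert k A) \<le> tail i"
      using infsum_y_mono infsum_start by metis
    from digit_sum_no_gap_point[OF infsum_y_in this, of c]
    have "(real c + 1) * \<alpha> i \<le> y k + infsum y A"
      unfolding v using A e by simp
    then show False
      using A e \<epsilon> by (simp add: gap_length_def algebra_simps)
  qed
  with e show ?thesis by (intro that[of c]) simp
qed

lemma start_0: "start 0 = 0"
  using digit_sum_le_tail_0[OF y_in] y_le_tail_iff by blast

lemma start_mono: "start i \<le> start (Suc i)"
  using y_le_tail_iff[of "start (Suc i)" "Suc i"] y_le_tail_iff[of "start (Suc i)" i]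
    tail_Suc_less[of i] by simp

text \<open>By \<open>y_multiple\<close> the quotient is an exact integer for indices from
  \<open>start i\<close> to just before \<open>start (Suc i)\<close>; the floor only changes its
  type.\<close>

definition coeff :: "nat \<Rightarrow> nat \<Rightarrow> nat" where
  "coeff i k = nat \<lfloor>y k / \<alpha> i\<rfloor>"

lemma y_eq_coeff:
  assumes "k \<in> {start i..<start (Suc i)}"
  shows "y k = real (coeff i k) * \<alpha> i"
proof -
  obtain c where "y k = real c * \<alpha> i"
    using y_multiple assms by auto
  then show ?thesis using alpha_pos[of i] by (simp add: coeff_def)
qed

lemma sum_coeff:
  assumes "A \<subseteq> {start i..<start (Suc i)}"
  shows "sum y A = real (sum (coeff i) A) * \<alpha> i"
proof -
  have "sum y A = (\<Sum>k\<in>A. real (coeff i k) * \<alpha> i)"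
    by (rule sum.cong[OF refl]) (use assms y_eq_coeff in blast)
  then show ?thesis by (simp add: sum_distrib_right)
qed

text \<open>The sum comes from \<open>infsum_start\<close> at \<open>i\<close> and
  \<open>Suc i\<close>, the semi-fast condition from that of \<open>y\<close>, and completeness from
  the multiples \<open>s * \<alpha> i\<close> being digit sums.\<close>

lemma coeff_partition: "rev (map (coeff i) [start i..<start (Suc i)]) \<in> semi_fast_partitions (N i)"
proof -
  let ?W = "{start i..<start (Suc i)}"
  have less: "coeff i p < coeff i q \<longleftrightarrow> y p < y q" if "p \<in> ?W" "q \<in> ?W" for p q
    using that alpha_pos[of i] by (simp add: y_eq_coeff)
  have mono: "coeff i q \<le> coeff i p" if "start i \<le> p" "p \<le> q" "q < start (Suc i)" for p q
  proof -
    have "\<not> y p < y q" using y_dec[OF that(2)] by simp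
    then show ?thesis using less[of p q] that by simp
  qed
  have pos: "0 < coeff i p" if "p \<in> ?W" for p
    using y_eq_coeff[OF that] y_pos[of p] by (cases "coeff i p") auto
  have sum: "sum (coeff i) ?W = N i"
  proof -
    have "real (N i) * \<alpha> i = sum y ?W"
      using infsum_atLeast_split[OF y_summable start_mono[of i]] tail_Suc[of i]
      by (simp add: infsum_start)
    then show ?thesis using sum_coeff[of ?W i] alpha_pos[of i]
      by (simp del: of_nat_sum)
  qed
  have complete: "{sum (coeff i) A | A. A \<subseteq> ?W} = {0..N i}"
  proof (intro equalityI subsetI)
    fix s assume "s \<in> {sum (coeff i) A | A. A \<subseteq> ?W}"
    then obtain A where A: "A \<subseteq> ?W" "s = sum (coeff i) A" by blast
    then have "s \<le> sum (coeff i) ?W"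
      by (auto intro: sum_mono2)
    then show "s \<in> {0..N i}" using sum by simp
  next
    fix s assume s: "s \<in> {0..N i}"
    then have "real s * \<alpha> i \<in> digit_sums"
      by (intro multiple_in_digit_sums) simp
    then obtain A where A: "real s * \<alpha> i = infsum y A" by (rule digit_sumsE)
    have "real s * \<alpha> i \<le> real (N i) * \<alpha> i"
      using s alpha_pos[of i] by (intro mult_right_mono) auto
    then have "infsum y A \<le> tail i"
      using tail_Suc[of i] tail_nonneg[of "Suc i"] A by simp
    then have "k \<in> {start i..}" if "k \<in> A" for k
      using y_le_infsum[OF that] y_le_tail_iff[of k i] by simp
    then have split: "A = A \<inter> ?W \<union> A \<inter> {start (Suc i)..}" by auto
    \<comment> \<open>The contribution from beyond the window is at most
      \<open>tail (Suc i) < \<alpha> i\<close>, so integrality leaves all of \<open>s\<close> to the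
      window.\<close>
    define r where "r = infsum y (A \<inter> {start (Suc i)..})"
    have "infsum y (A \<inter> ?W \<union> A \<inter> {start (Suc i)..}) = infsum y (A \<inter> ?W) + r"
      unfolding r_def by (intro infsum_Un_disjoint y_summable) auto
    then have "infsum y A = infsum y (A \<inter> ?W) + r"
      by (simp only: split[symmetric])
    then have eq: "real s * \<alpha> i = real (sum (coeff i) (A \<inter> ?W)) * \<alpha> i + r"
      using sum_coeff[of "A \<inter> ?W" i] A by simp
    have r: "0 \<le> r" "r < \<alpha> i"
      using infsum_y_mono[of "A \<inter> {start (Suc i)..}" "{start (Suc i)..}"] tail_less[of i]
      by (auto simp: r_def infsum_start intro!: infsum_nonneg y_nonneg)
    have "real (sum (coeff i) (A \<inter> ?W)) * \<alpha> i \<le> real s * \<alpha> i"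
      "real s * \<alpha> i < (real (sum (coeff i) (A \<inter> ?W)) + 1) * \<alpha> i"
      using eq r by (auto simp: algebra_simps)
    then have "sum (coeff i) (A \<inter> ?W) \<le> s" "s < sum (coeff i) (A \<inter> ?W) + 1"
      using alpha_pos[of i] by (simp_all del: of_nat_sum)
    then have "s = sum (coeff i) (A \<inter> ?W)" by simp
    then show "s \<in> {sum (coeff i) A | A. A \<subseteq> ?W}" by blast
  qed
  have fast: "(\<Sum>q | q \<in> ?W \<and> coeff i q < coeff i p. coeff i q) < coeff i p" if p: "p \<in> ?W" for p
  proof -
    let ?B = "{q. q \<in> ?W \<and> coeff i q < coeff i p}"
    have "real (sum (coeff i) ?B) * \<alpha> i = sum y ?B"
      by (rule sum_coeff[symmetric]) auto
    also have "\<dots> = infsum y ?B" by simp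
    also have "\<dots> \<le> infsum y {k. y k < y p}"
      using less p by (intro infsum_y_mono) auto
    also have "\<dots> < real (coeff i p) * \<alpha> i"
      using y_fast[of p] y_eq_coeff[OF p] by simp
    finally show ?thesis using alpha_pos[of i] by (simp del: of_nat_sum)
  qed
  show ?thesis
    unfolding semi_fast_partitions_iff
  proof (intro conjI)
    show "\<forall>p q. start i \<le> p \<longrightarrow> p \<le> q \<longrightarrow> q < start (Suc i) \<longrightarrow> coeff i q \<le> coeff i p"
      using mono by blast
    show "\<forall>p\<in>?W. 0 < coeff i p"
      using pos by blast
    show "sum (coeff i) ?W = N i"
      by (fact sum)
    show "{sum (coeff i) A | A. A \<subseteq> ?W} = {0..N i}"
      by (fact complete)
    show "\<forall>p\<in>?W. (\<Sum>q | q \<in> ?W \<and> coeff i q < coeff i p. coeff i q) < coeff i p"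
      using fast by blast
  qed
qed

end

section \<open>Representations from families of partitions\<close>

context gapped_blocks
begin

text \<open>Block \<open>i\<close> has \<open>length (f i)\<close> terms. The lists are reversed
  because partitions ascend while the sequence has to descend.\<close>

definition join :: "(nat \<Rightarrow> nat list) \<Rightarrow> nat \<Rightarrow> real" where
  "join f n = (let i = (LEAST k. n < (\<Sum>j\<le>k. length (f j)))
     in real (rev (f i) ! (n - offset (\<lambda>j. length (f j)) i)) * \<alpha> i)"

end

locale partition_family = gapped_blocks +
  fixes f :: "nat \<Rightarrow> nat list"
  assumes partition: "f i \<in> semi_fast_partitions (N i)"
begin

definition L :: "nat \<Rightarrow> nat" where
  "L i = length (f i)"

lemma L_pos: "0 < L i"
  using partition[of i] N_pos[of i] by (cases "f i") (auto simp: L_def semi_fast_partitions_def)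

definition mult :: "nat \<Rightarrow> nat" where
  "mult n = (let i = (LEAST k. n < (\<Sum>j\<le>k. L j)) in rev (f i) ! (n - offset L i))"

lemma mult_block: "n \<in> block L i \<Longrightarrow> mult n = rev (f i) ! (n - offset L i)"
  using block_Least[of n L i] by (simp add: mult_def)

lemma join_block: "n \<in> block L i \<Longrightarrow> join f n = real (mult n) * \<alpha> i"
  using block_Least[of n L i] mult_block[of n i] by (simp add: join_def L_def[abs_def])

lemma f_eq: "f i = rev (map mult [offset L i..<offset L (Suc i)])"
proof -
  have "map mult [offset L i..<offset L (Suc i)] =
      map (\<lambda>n. rev (f i) ! (n - offset L i)) [offset L i..<offset L (Suc i)]"
    by (intro map_cong refl mult_block) auto
  also have "rev \<dots> = f i"
    by (rule rev_map_upt_nth_rev) (simp add: offset_Suc L_def)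
  finally show ?thesis by simp
qed

lemma
  shows mult_mono: "offset L i \<le> p \<Longrightarrow> p \<le> q \<Longrightarrow> q < offset L (Suc i) \<Longrightarrow> mult q \<le> mult p"
    and mult_pos: "p \<in> block L i \<Longrightarrow> 0 < mult p"
    and mult_sum: "sum mult (block L i) = N i"
    and mult_complete: "{sum mult A | A. A \<subseteq> block L i} = {0..N i}"
    and mult_fast: "p \<in> block L i \<Longrightarrow> (\<Sum>q | q \<in> block L i \<and> mult q < mult p. mult q) < mult p"
  using partition[of i] unfolding f_eq[of i] semi_fast_partitions_iff by blast+

lemma mult_sum_le: "sum mult (A \<inter> block L i) \<le> N i"
  using sum_mono2[of "block L i" "A \<inter> block L i" mult] mult_sum[of i] by simp

lemma mult_le: "n \<in> block L i \<Longrightarrow> mult n \<le> N i"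
  using mult_sum_le[of "{n}" i] by (simp add: Int_absorb2)

lemma join_sum_block: "sum (join f) (A \<inter> block L i) = real (sum mult (A \<inter> block L i)) * \<alpha> i"
proof -
  have "sum (join f) (A \<inter> block L i) = (\<Sum>n\<in>A \<inter> block L i. real (mult n) * \<alpha> i)"
    by (rule sum.cong[OF refl]) (use join_block in blast)
  then show ?thesis by (simp add: sum_distrib_right)
qed

lemma join_bounds:
  assumes "n \<in> block L i"
  shows "\<alpha> i \<le> join f n" "join f n \<le> tail i"
  using digit_mono[of 1 "mult n" i] digit_mono[of "mult n" "N i" i] mult_pos[OF assms]
    mult_le[OF assms] join_block[OF assms] tail_Suc[of i] tail_nonneg[of "Suc i"] by auto

lemma join_pos: "0 < join f n"
proof -
  obtain i where "n \<in> block L i" using in_some_block L_pos by blast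
  then show ?thesis using join_bounds(1)[of n i] alpha_pos[of i] by simp
qed

lemma join_nonneg: "0 \<le> join f n"
  using join_pos by (rule less_imp_le)

lemma join_summable: "join f summable_on A"
proof -
  have "join f summable_on (\<Union>i. block L i)"
  proof (rule summable_on_UnionI)
    fix i
    show "(join f has_sum (real (N i) * \<alpha> i)) (block L i)"
      using has_sum_finite[of "block L i" "join f"] join_sum_block[of UNIV i]
      by (simp only: Int_UNIV_left mult_sum finite_atLeastLessThan)
  next
    show "disjoint_family (block L)"
      using disjoint_family_on_block[of UNIV L] by simp
  qed (rule summable_terms join_nonneg)+
  then show ?thesis
    unfolding UN_block[OF L_pos] by (rule summable_on_subset_banach) simp
qed

lemma infsum_join: "infsum (join f) A = (\<Sum>\<^sub>\<infinity>i. real (sum mult (A \<inter> block L i)) * \<alpha> i)"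
  unfolding join_sum_block[symmetric] by (intro infsum_blocks join_summable L_pos)

text \<open>A whole block adds up to \<open>N i * \<alpha> i\<close> whatever the partition.\<close>

lemma infsum_join_tail: "infsum (join f) {offset L k..} = tail k"
  unfolding infsum_join tail_def
proof (rule infsum_cong_neutral)
  fix i assume "i \<in> UNIV - {k..}"
  then have "{offset L k..} \<inter> block L i = {}"
    using offset_mono[of "Suc i" k L] by auto
  then show "real (sum mult ({offset L k..} \<inter> block L i)) * \<alpha> i = 0" by simp
next
  fix i assume "i \<in> UNIV \<inter> {k..}"
  then have "{offset L k..} \<inter> block L i = block L i"
    using offset_mono[of k i L] by auto
  then show "real (sum mult ({offset L k..} \<inter> block L i)) * \<alpha> i = real (N i) * \<alpha> i"
    by (simp only: mult_sum)
qed auto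

text \<open>A set of indices yields one digit of at most \<open>N i\<close> per block; conversely,
  completeness of the partition realizes each such digit by a subset of its block.\<close>

lemma achievement_set_join: "achievement_set (join f) = digit_sums"
proof (intro equalityI subsetI)
  fix v assume "v \<in> achievement_set (join f)"
  then obtain A where v: "v = infsum (join f) A" by (auto simp: achievement_set_def)
  let ?d = "\<lambda>i. sum mult (A \<inter> block L i)"
  have "v = (\<Sum>\<^sub>\<infinity>i. real (?d i) * \<alpha> i)"
    unfolding v by (rule infsum_join)
  moreover have "\<forall>i. ?d i \<le> N i"
    by (intro allI mult_sum_le)
  ultimately show "v \<in> digit_sums"
    unfolding digit_sums_def by (intro CollectI exI[of _ ?d] conjI)
next
  fix v assume "v \<in> digit_sums"
  then obtain d where d: "\<And>i. d i \<le> N i" and v: "v = (\<Sum>\<^sub>\<infinity>i. real (d i) * \<alpha> i)"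
    by (auto simp: digit_sums_def)
  have "\<forall>i. \<exists>B. B \<subseteq> block L i \<and> sum mult B = d i"
  proof
    fix i
    have "d i \<in> {sum mult A | A. A \<subseteq> block L i}"
      unfolding mult_complete using d[of i] by simp
    then show "\<exists>B. B \<subseteq> block L i \<and> sum mult B = d i"
      by (elim CollectE exE conjE) (intro exI conjI, assumption, rule sym)
  qed
  from choice[OF this] obtain B where "\<forall>i. B i \<subseteq> block L i \<and> sum mult (B i) = d i" ..
  then have B: "B i \<subseteq> block L i" "sum mult (B i) = d i" for i
    by simp_all
  have int: "(\<Union>j. B j) \<inter> block L i = B i" for i
    using B(1) block_unique[of _ L] by blast
  have "v = infsum (join f) (\<Union>j. B j)"
    unfolding infsum_join v by (simp only: int B(2))
  then show "v \<in> achievement_set (join f)"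
    unfolding achievement_set_def by (intro CollectI exI[of _ "\<Union>j. B j"]) simp
qed

text \<open>Terms of block \<open>j\<close> lie between \<open>\<alpha> j\<close> and
  \<open>tail j\<close>, and \<open>tail i < \<alpha> j\<close> for \<open>j < i\<close>. The block
  boundaries can thus be read off the values.\<close>

lemma join_le_tail_iff: "join f n \<le> tail i \<longleftrightarrow> offset L i \<le> n"
proof -
  obtain j where j: "n \<in> block L j" using in_some_block L_pos by blast
  show ?thesis
  proof (cases "i \<le> j")
    case True
    then show ?thesis
      using join_bounds(2)[OF j] tail_antimono[of i j] offset_mono[of i j L] j by auto
  next
    case False
    then show ?thesis
      using join_bounds(1)[OF j] tail_less_alpha[of j i] offset_mono[of "Suc j" i L] j by auto
  qed
qed

lemma decseq_join: "decseq (join f)"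
  unfolding decseq_def
proof (intro allI impI)
  fix m n :: nat assume mn: "m \<le> n"
  obtain i where i: "m \<in> block L i" using in_some_block L_pos by blast
  show "join f n \<le> join f m"
  proof (cases "n < offset L (Suc i)")
    case True
    then have n: "n \<in> block L i" using mn i by auto
    then show ?thesis
      unfolding join_block[OF i] join_block[OF n]
      using i mn mult_mono[of i m n] by (intro digit_mono) simp
  next
    case False
    then show ?thesis
      using join_le_tail_iff[of n "Suc i"] join_bounds(1)[OF i] tail_less[of i] by simp
  qed
qed

text \<open>Smaller terms lie in the same block with a smaller multiplier, or in a later block. The
  former add up to at most \<open>join f n - \<alpha> i\<close>, the latter to at most
  \<open>tail (Suc i) < \<alpha> i\<close>.\<close>

lemma semi_fast_join: "infsum (join f) {k. join f k < join f n} < join f n"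
proof -
  obtain i where i: "n \<in> block L i" using in_some_block L_pos by blast
  let ?S = "{k. join f k < join f n}"
  let ?A = "{q. q \<in> block L i \<and> mult q < mult n}"
  let ?T = "{offset L (Suc i)..}"
  have "?S \<subseteq> ?A \<union> ?T"
  proof
    fix k assume k: "k \<in> ?S"
    then have "join f k \<le> tail i"
      using join_bounds(2)[OF i] by simp
    then have "offset L i \<le> k"
      by (simp add: join_le_tail_iff)
    then have "k \<in> block L i \<or> k \<in> ?T" by auto
    then show "k \<in> ?A \<union> ?T"
      using k alpha_pos[of i] by (auto simp: join_block[OF i] join_block[of k i])
  qed
  then have "infsum (join f) ?S \<le> infsum (join f) (?A \<union> ?T)"
    by (intro infsum_mono2 join_summable join_nonneg)
  also have "\<dots> = infsum (join f) ?A + tail (Suc i)"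
    unfolding infsum_join_tail[symmetric] by (intro infsum_Un_disjoint join_summable) auto
  also have "infsum (join f) ?A = sum (join f) (?A \<inter> block L i)"
    by (simp add: Int_absorb2 subset_eq)
  also have "\<dots> = real (sum mult ?A) * \<alpha> i"
    by (subst join_sum_block, rule arg_cong[of _ _ "\<lambda>A. real (sum mult A) * \<alpha> i"]) auto
  also have "\<dots> + tail (Suc i) < real (sum mult ?A) * \<alpha> i + \<alpha> i"
    using tail_less[of i] by simp
  also have "\<dots> = real (Suc (sum mult ?A)) * \<alpha> i"
    by (simp add: algebra_simps)
  also have "\<dots> \<le> join f n"
    unfolding join_block[OF i] using mult_fast[OF i] by (intro digit_mono) simp
  finally show ?thesis .
qed

lemma join_representation: "join f \<in> semi_fast_representations digit_sums"
proof -
  have "summable (join f)"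
    using join_summable[of UNIV] by (rule summable_on_imp_summable)
  then show ?thesis
    using decseq_join join_pos semi_fast_join achievement_set_join
    by (simp add: semi_fast_representations_def semi_fast_convergent_def admissible_seq_def)
qed

end

section \<open>The bijection between families of partitions and representations\<close>

context gapped_blocks
begin

abbreviation partition_families :: "(nat \<Rightarrow> nat list) set" where
  "partition_families \<equiv> Pi UNIV (\<lambda>i. semi_fast_partitions (N i))"

lemma partition_familyI: "f \<in> partition_families \<Longrightarrow> partition_family \<alpha> N f"
  by unfold_locales auto

text \<open>By \<open>join_le_tail_iff\<close> the sequence determines the block boundaries;
  dividing by \<open>\<alpha> i\<close> then determines the multipliers.\<close>

lemma inj_on_join: "inj_on join partition_families"
proof (rule inj_onI)
  fix f g assume "f \<in> partition_families" "g \<in> partition_families" and eq: "join f = join g"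
  then interpret f: partition_family \<alpha> N f + g: partition_family \<alpha> N g
    by (simp_all add: partition_familyI)
  have "offset f.L i \<le> n \<longleftrightarrow> offset g.L i \<le> n" for i n
    using f.join_le_tail_iff[of n i] g.join_le_tail_iff[of n i] eq by simp
  then have off: "offset f.L i = offset g.L i" for i
    by (metis order_refl order_antisym)
  have mult: "f.mult n = g.mult n" if "n \<in> block f.L i" for n i
    using f.join_block[OF that] g.join_block[of n i] that alpha_pos[of i] eq by (simp add: off)
  show "f = g"
  proof
    fix i
    have "map f.mult [offset f.L i..<offset f.L (Suc i)] = map g.mult [offset g.L i..<offset g.L (Suc i)]"
      using mult[of _ i] by (intro map_cong) (auto simp: off)
    then show "f i = g i"
      by (subst f.f_eq, subst g.f_eq) (rule arg_cong)
  qed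
qed

text \<open>The multipliers \<open>coeff\<close> form a family whose block boundaries are the
  indices \<open>start i\<close>, so \<open>join\<close> restores \<open>y\<close> from it.\<close>

lemma representation_in_join:
  assumes "y \<in> semi_fast_representations digit_sums"
  shows "y \<in> join ` partition_families"
proof -
  interpret y: digit_sums_representation \<alpha> N y
    using assms by unfold_locales (auto simp: semi_fast_representations_def)
  define f where "f i = rev (map (y.coeff i) [y.start i..<y.start (Suc i)])" for i
  have f: "f \<in> partition_families"
    unfolding f_def using y.coeff_partition by blast
  then interpret f: partition_family \<alpha> N f by (rule partition_familyI)
  have off: "offset f.L i = y.start i" for i
  proof (induction i)
    case 0
    then show ?case by (simp add: offset_def y.start_0)
  next
    case (Suc i)
    then show ?case using y.start_mono[of i] f.L_def[of i] by (simp add: offset_Suc f_def[of i])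
  qed
  have "join f n = y n" for n
  proof -
    obtain i where i: "n \<in> block f.L i" using in_some_block f.L_pos by blast
    then have n: "n \<in> {y.start i..<y.start (Suc i)}" by (simp add: off)
    have "f.mult n = y.coeff i n"
    proof -
      have "map (y.coeff i) [y.start i..<y.start (Suc i)] ! (n - y.start i) = y.coeff i n"
        using n by (subst nth_map_upt) auto
      then show ?thesis
        by (simp add: f.mult_block[OF i] off f_def)
    qed
    then show ?thesis
      using f.join_block[OF i] y.y_eq_coeff[OF n] by simp
  qed
  then have "join f = y" by (rule ext)
  then show ?thesis using f by (rule image_eqI[OF sym])
qed

lemma bij_betw_join: "bij_betw join partition_families (semi_fast_representations digit_sums)"
proof -
  have "join ` partition_families \<subseteq> semi_fast_representations digit_sums"
    using partition_family.join_representation[OF partition_familyI] by blast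
  then show ?thesis
    unfolding bij_betw_def using inj_on_join representation_in_join by blast
qed

lemma join_replicate: "join (\<lambda>i. replicate (N i) 1) = block_seq \<alpha> N"
proof
  fix n
  obtain i where i: "n \<in> block N i" using in_some_block N_pos by blast
  then have "n - offset N i < N i" by (auto simp: offset_Suc)
  then show "join (\<lambda>i. replicate (N i) 1) n = block_seq \<alpha> N n"
    using block_Least[OF i] by (simp add: join_def block_seq_def)
qed

lemma replicate_in_partition_families: "(\<lambda>i. replicate (N i) 1) \<in> partition_families"
  using replicate_in_semi_fast_partitions by blast

lemma achievement_set_block_seq: "achievement_set (block_seq \<alpha> N) = digit_sums"
  using partition_family.achievement_set_join[OF partition_familyI[OF replicate_in_partition_families]]
  by (simp only: join_replicate)

end

section \<open>Counting\<close>

text \<open>A function is encoded by its graph, a set of naturals, and there are as many such sets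
  as reals.\<close>

lemma Pi_lepoll_reals:
  fixes F :: "nat \<Rightarrow> 'a :: countable set"
  shows "Pi UNIV F \<lesssim> (UNIV :: real set)"
proof -
  let ?h = "\<lambda>f :: nat \<Rightarrow> 'a. range (\<lambda>i. prod_encode (i, to_nat (f i)))"
  have "f = g" if "?h f = ?h g" for f g
  proof
    fix i
    have "prod_encode (i, to_nat (f i)) \<in> ?h g"
      unfolding that[symmetric] by (rule rangeI)
    then show "f i = g i"
      by auto
  qed
  then have "Pi UNIV F \<lesssim> (UNIV :: nat set set)"
    unfolding lepoll_def by (intro exI[of _ ?h]) (auto intro!: inj_onI)
  then show ?thesis
    using nat_sets_eqpoll_reals lepoll_trans2 by blast
qed

lemma reals_lepoll_Pi:
  fixes F :: "nat \<Rightarrow> 'a set"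
  assumes "\<And>i. a i \<in> F i" "infinite {i. F i \<noteq> {a i}}"
  shows "(UNIV :: real set) \<lesssim> Pi UNIV F"
proof -
  let ?B = "{i. F i \<noteq> {a i}}"
  have "\<exists>x. i \<in> ?B \<longrightarrow> x \<in> F i \<and> x \<noteq> a i" for i
    using assms(1)[of i] by blast
  then obtain b where b: "\<And>i. i \<in> ?B \<Longrightarrow> b i \<in> F i \<and> b i \<noteq> a i"
    by metis
  obtain e :: "nat \<Rightarrow> nat" where e: "inj e" "range e \<subseteq> ?B"
    using assms(2) unfolding infinite_le_lepoll lepoll_def by blast
  \<comment> \<open>\<open>h S\<close> departs from \<open>a\<close> exactly at the positions
    \<open>e k\<close> with \<open>k \<in> S\<close>, so \<open>S\<close> can be recovered from
    it.\<close>
  define h where "h S i = (if i \<in> e ` S then b i else a i)" for S i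
  have "e k \<in> ?B" for k
    using e(2) by blast
  then have be: "b (e k) \<in> F (e k)" "b (e k) \<noteq> a (e k)" for k
    using b by blast+
  have h: "{i. h S i \<noteq> a i} = e ` S" for S
    using be(2) by (auto simp: h_def)
  have "inj h"
  proof (rule injI)
    fix S T assume "h S = h T"
    then have "{i. h S i \<noteq> a i} = {i. h T i \<noteq> a i}"
      by (simp only:)
    then show "S = T"
      unfolding h using e(1) by (simp only: inj_image_eq_iff)
  qed
  moreover have "h S \<in> Pi UNIV F" for S
  proof (rule Pi_I)
    fix i show "h S i \<in> F i"
      using assms(1)[of i] be(1) by (cases "i \<in> e ` S") (auto simp: h_def)
  qed
  ultimately have "(UNIV :: nat set set) \<lesssim> Pi UNIV F"
    unfolding lepoll_def by (intro exI[of _ h] conjI image_subsetI)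
  then show ?thesis
    using nat_sets_eqpoll_reals eqpoll_sym lepoll_trans1 by blast
qed

lemma bij_betw_restrict_Pi:
  assumes "\<And>i. i \<notin> B \<Longrightarrow> F i = {a i}"
  shows "bij_betw (\<lambda>f. restrict f B) (Pi UNIV F) (Pi\<^sub>E B F)"
proof (rule bij_betwI)
  show "(\<lambda>g i. if i \<in> B then g i else a i) \<in> Pi\<^sub>E B F \<rightarrow> Pi UNIV F"
    using assms by (auto simp: PiE_def Pi_def)
next
  fix f assume "f \<in> Pi UNIV F"
  then show "(\<lambda>i. if i \<in> B then restrict f B i else a i) = f"
    using assms by (force simp: Pi_def)
next
  fix g assume "g \<in> Pi\<^sub>E B F"
  then show "restrict (\<lambda>i. if i \<in> B then g i else a i) B = g"
    by (auto simp: PiE_def extensional_def)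
qed auto

section \<open>Passage from the block sequence\<close>

lemma block_seq_block: "n \<in> block N i \<Longrightarrow> block_seq \<alpha> N n = \<alpha> i"
  by (simp add: block_seq_def block_Least)

lemma gapped_blocksI:
  assumes alpha_pos: "\<And>k. 0 < \<alpha> k"
    and alpha_dec: "\<And>k. \<alpha> (Suc k) < \<alpha> k"
    and N_pos: "\<And>k. 0 < N k"
    and semi_fast: "semi_fast_convergent (block_seq \<alpha> N)"
    and gap: "\<And>i. \<alpha> i > (real (N (Suc i)) + 1) * \<alpha> (Suc i)"
  shows "gapped_blocks \<alpha> N"
proof
  let ?y = "block_seq \<alpha> N"
  have pos: "0 < ?y n" for n
    using alpha_pos by (simp add: block_seq_def)
  have "summable ?y"
    using semi_fast by (simp add: semi_fast_convergent_def admissible_seq_def)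
  then have summable: "?y summable_on A" for A
    using summable_nonneg_imp_summable_on[of ?y] pos
    by (meson less_imp_le subset_UNIV summable_on_subset_banach)
  have block: "infsum ?y (block N i) = real (N i) * \<alpha> i" for i
  proof -
    have "infsum ?y (block N i) = (\<Sum>n\<in>block N i. \<alpha> i)"
      by (simp add: block_seq_block)
    then show ?thesis by (simp add: offset_Suc)
  qed
  have disjoint: "disjoint_family_on (block N) I" for I
    using disjoint_family_on_block[of UNIV N I] by simp
  show "(\<lambda>i. real (N i) * \<alpha> i) summable_on UNIV"
    using summable_on_UN_disjoint_family[OF summable disjoint, of UNIV] by (simp only: block)
  fix i
  have "infsum ?y {offset N (Suc i)..} = (\<Sum>\<^sub>\<infinity>j\<in>{Suc i..}. real (N j) * \<alpha> j)"
    using infsum_UN_disjoint_family[OF summable disjoint, of "{Suc i..}"] UN_block_atLeast[of N "Suc i"] N_pos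
    by (simp only: block)
  \<comment> \<open>The semi-fast condition is used at the first index of block \<open>i\<close>: as
    \<open>\<alpha>\<close> strictly decreases, the smaller terms are those of the later
    blocks.\<close>
  moreover have "{k. ?y k < ?y (offset N i)} = {offset N (Suc i)..}"
  proof -
    have "?y k < ?y (offset N i) \<longleftrightarrow> offset N (Suc i) \<le> k" for k
    proof -
      obtain j where j: "k \<in> block N j" using in_some_block N_pos by blast
      have "?y (offset N i) = \<alpha> i"
        using N_pos by (intro block_seq_block) (simp add: offset_Suc)
      moreover have "\<alpha> j < \<alpha> i \<longleftrightarrow> i < j"
        using lift_Suc_mono_less_iff[of "\<lambda>k. - \<alpha> k" i j] alpha_dec by simp
      moreover have "i < j \<longleftrightarrow> offset N (Suc i) \<le> k"
        using j offset_mono[of "Suc i" j N] offset_mono[of "Suc j" "Suc i" N] by (cases "i < j") auto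
      ultimately show ?thesis by (simp add: block_seq_block[OF j])
    qed
    then show ?thesis by auto
  qed
  moreover have "?y (offset N i) = \<alpha> i"
    using N_pos by (intro block_seq_block) (simp add: offset_Suc)
  moreover have "infsum ?y {k. ?y k < ?y (offset N i)} < ?y (offset N i)"
    using semi_fast by (simp add: semi_fast_convergent_def)
  ultimately show "(\<Sum>\<^sub>\<infinity>j\<in>{Suc i..}. real (N j) * \<alpha> j) < \<alpha> i"
    by simp
qed (rule alpha_pos N_pos gap)+

theorem corollary2p13:
  fixes \<alpha> :: "nat \<Rightarrow> real" and N :: "nat \<Rightarrow> nat"
  assumes alpha_pos: "\<And>k. 0 < \<alpha> k"
    and alpha_dec: "\<And>k. \<alpha> (Suc k) < \<alpha> k"
    and alpha_lim: "\<alpha> \<longlonglongrightarrow> 0"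
    and N_pos: "\<And>k. 0 < N k"
    and semi_fast: "semi_fast_convergent (block_seq \<alpha> N)"
    and gap: "\<And>i. \<alpha> i > (real (N (Suc i)) + 1) * \<alpha> (Suc i)"
  shows
    "(semi_fast_representations (achievement_set (block_seq \<alpha> N)) \<approx> (UNIV :: real set)
        \<longleftrightarrow> infinite {i. \<not> prime (N i + 1)})
     \<and> (finite {i. \<not> prime (N i + 1)} \<longrightarrow>
          finite (semi_fast_representations (achievement_set (block_seq \<alpha> N))) \<and>
          (\<lambda>i. real (R (N i))) has_prod
             real (card (semi_fast_representations (achievement_set (block_seq \<alpha> N)))))
     \<and> ((\<exists>!x. x \<in> semi_fast_representations (achievement_set (block_seq \<alpha> N)))
          \<longleftrightarrow> (\<forall>i. prime (N i + 1)))
     \<and> ((\<forall>i. prime (N i + 1)) \<longrightarrow>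
          semi_fast_representations (achievement_set (block_seq \<alpha> N)) = {block_seq \<alpha> N})"
proof -
  interpret gapped_blocks \<alpha> N
    using assms by (intro gapped_blocksI)
  let ?F = "\<lambda>i. semi_fast_partitions (N i)"
  let ?B = "{i. \<not> prime (N i + 1)}"
  define S where "S = semi_fast_representations (achievement_set (block_seq \<alpha> N))"
  have bij: "bij_betw join (Pi UNIV ?F) S"
    unfolding S_def achievement_set_block_seq by (rule bij_betw_join)
  then have eqpoll: "Pi UNIV ?F \<approx> S"
    unfolding eqpoll_def by blast
  have B: "?F i = {replicate (N i) 1} \<longleftrightarrow> i \<notin> ?B" for i
    using semi_fast_partitions_prime semi_fast_partitions_not_prime[OF _ N_pos] by blast
  have B': "{i. ?F i \<noteq> {replicate (N i) 1}} = ?B"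
    using B by blast
  have uncountable: "S \<approx> (UNIV :: real set)" if "infinite ?B"
  proof -
    have "Pi UNIV ?F \<approx> (UNIV :: real set)"
      using that replicate_in_semi_fast_partitions B'
      by (intro lepoll_antisym Pi_lepoll_reals reals_lepoll_Pi[where a = "\<lambda>i. replicate (N i) 1"]) auto
    with eqpoll show ?thesis
      using eqpoll_sym eqpoll_trans by blast
  qed
  have finite: "finite S \<and> (\<lambda>i. real (R (N i))) has_prod real (card S)" if "finite ?B"
  proof -
    have restrict: "bij_betw (\<lambda>f. restrict f ?B) (Pi UNIV ?F) (Pi\<^sub>E ?B ?F)"
      using B by (intro bij_betw_restrict_Pi[where a = "\<lambda>i. replicate (N i) 1"]) blast
    have "finite (Pi\<^sub>E ?B ?F)"
      using that by (intro finite_PiE finite_semi_fast_partitions)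
    then have "finite S"
      using bij_betw_finite[OF bij] bij_betw_finite[OF restrict] by simp
    moreover have "card S = (\<Prod>i\<in>?B. R (N i))"
      using bij_betw_same_card[OF bij] bij_betw_same_card[OF restrict] card_PiE[OF that, of ?F]
      by (simp only: R_eq_card)
    \<comment> \<open>By \<open>R_eq_1_iff\<close> all factors outside \<open>?B\<close> are 1, so
      the infinite product is a finite one.\<close>
    moreover have "(\<lambda>i. real (R (N i))) has_prod (\<Prod>i\<in>?B. real (R (N i)))"
      using that N_pos R_eq_1_iff by (intro has_prod_finite) auto
    ultimately show ?thesis by simp
  qed
  have block_in: "block_seq \<alpha> N \<in> S"
    using semi_fast by (simp add: S_def semi_fast_representations_def)
  have all_prime: "S = {block_seq \<alpha> N}" if "\<forall>i. prime (N i + 1)"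
  proof -
    have "Pi UNIV ?F \<subseteq> {\<lambda>i. replicate (N i) 1}"
      using that B by (auto simp: Pi_def fun_eq_iff)
    then have "S \<subseteq> {join (\<lambda>i. replicate (N i) 1)}"
      using bij by (auto simp: bij_betw_def)
    then show ?thesis using block_in unfolding join_replicate by blast
  qed
  have unique: "\<forall>i. prime (N i + 1)" if "\<exists>!x. x \<in> S"
  proof (rule ccontr)
    assume "\<not> (\<forall>i. prime (N i + 1))"
    then obtain i zs where i: "zs \<in> ?F i" "zs \<noteq> replicate (N i) 1"
      using semi_fast_partitions_not_prime[OF _ N_pos] by blast
    \<comment> \<open>Altering the all-ones family in the single block \<open>i\<close> gives a
      second representation.\<close>
    let ?f = "\<lambda>j. replicate (N j) 1"
    have fg: "?f \<in> Pi UNIV ?F" "?f(i := zs) \<in> Pi UNIV ?F" "?f(i := zs) \<noteq> ?f"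
      using i replicate_in_semi_fast_partitions by (auto simp: fun_eq_iff)
    then have "join ?f \<noteq> join (?f(i := zs))" "join ?f \<in> S" "join (?f(i := zs)) \<in> S"
      using bij by (auto simp: bij_betw_def inj_on_def)
    with that show False by blast
  qed
  have "S \<approx> (UNIV :: real set) \<longleftrightarrow> infinite ?B"
    using uncountable finite eqpoll_finite_iff infinite_UNIV_char_0 by blast
  then show ?thesis
    unfolding S_def[symmetric] using finite all_prime unique by blast
qed

end
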